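(* Under the setting of the context, consider the relaxed MPC problem $$\hat J_N^*(x;\delta)=\min_{\mathbf u}\sum_{k=0}^{N-1}\hat\ell(x_k,u_k)+x_N^\top Px_N\quad\text{s.t. }x_0=x,\ x_{k+1}=Ax_k+Bu_k,$$ where $P$ is as in the context. Then, independently of the relaxation parameter $\delta>0$ (satisfying the admissibility condition), the feedback $u(k)=\hat u_0^*(x(k))$ asymptotically stabilizes the origin of $x(k+1)=Ax(k)+Bu(k)$ for any initial condition $x(0)\in\mathbb{R}^n$.
   Context: System $x(k+1)=Ax(k)+Bu(k)$, $x\in\mathbb{R}^n$, $u\in\mathbb{R}^m$, $(A,B)$ stabilizable. Polytopes $\mathcal{X}=\{x:C_xx\le d_x\}$, $\mathcal{U}=\{u:C_uu\le d_u\}$ (compact), $d_x,d_u$ entrywise strictly positive; $C^i$ row $i$, $d^i$ entry $i$; $\mathbf 1$ all-ones vector. Stage cost $\ell(x,u)=x^\top Qx+u^\top Ru$, $Q\succeq0$, $R\succ0$; horizon $N\ge1$; $\varepsilon>0$. Quadratic relaxed barrier: $\delta>0$, $\beta_2(z;\delta)=\frac12[(\frac{z-2\delta}{\delta})^2-1]-\ln\delta$, $\hat B(z)=-\ln z$ for $z>\delta$ and $\beta_2(z;\delta)$ for $z\le\delta$. With $z_x^i(x)=-C_x^ix+d_x^i$, $\hat B_x=\sum_i\hat B_{x,i}$ where either $\hat B_{x,i}(x)=\hat B(z_x^i(x))+\ln d_x^i-C_x^ix/d_x^i$ (gradient recentering, set $w_x=0$) or $\hat B_{x,i}(x)=(1+w_x^i)(\hat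 B(z_x^i(x))+\ln d_x^i)$ with $w_x\ge0$, $\sum_i(1+w_x^i)(C_x^i)^\top/d_x^i=0$ (weight recentering); $\hat B_u$ analogously with $w_u$. Admissibility: $\hat B_x(0)=\hat B_u(0)=0$, $\nabla\hat B_x(0)=\nabla\hat B_u(0)=0$. $\hat\ell(x,u)=\ell(x,u)+\varepsilon\hat B_u(u)+\varepsilon\hat B_x(x)$. Terminal matrix: $M_x=\frac{1}{2\delta^2}C_x^\top\mathrm{diag}(\mathbf 1+w_x)C_x$, $M_u=\frac{1}{2\delta^2}C_u^\top\mathrm{diag}(\mathbf 1+w_u)C_u$; $K$ and symmetric positive definite $P$ solve the modified Riccati equation $K=-(R+B^\top PB+\varepsilon M_u)^{-1}B^\top PA$, $P=A_K^\top PA_K+K^\top(R+\varepsilon M_u)K+Q+\varepsilon M_x$ with $A_K=A+BK$. *)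

theory Defs
  imports "HOL-Analysis.Analysis"
begin

definition psd_mat :: "real^'n^'n \<Rightarrow> bool" where
  "psd_mat M \<longleftrightarrow> transpose M = M \<and> (\<forall>x. 0 \<le> x \<bullet> (M *v x))"

definition pd_mat :: "real^'n^'n \<Rightarrow> bool" where
  "pd_mat M \<longleftrightarrow> transpose M = M \<and> (\<forall>x. x \<noteq> 0 \<longrightarrow> 0 < x \<bullet> (M *v x))"

definition schur_stable :: "real^'n^'n \<Rightarrow> bool" where
  "schur_stable M \<longleftrightarrow>
     (\<forall>(lam::complex) (v::complex^'n). v \<noteq> 0 \<and>
        (\<chi> i j. complex_of_real (M $ i $ j)) *v v = lam *s v \<longrightarrow> cmod lam < 1)"

definition stabilizable :: "real^'n^'n \<Rightarrow> real^'m^'n \<Rightarrow> bool" where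
  "stabilizable A B \<longleftrightarrow> (\<exists>K::real^'n^'m. schur_stable (A + B ** K))"

definition diag_mat :: "real^'p \<Rightarrow> real^'p^'p" where
  "diag_mat w = (\<chi> i j. if i = j then w $ i else 0)"

definition beta2 :: "real \<Rightarrow> real \<Rightarrow> real" where
  "beta2 \<delta> z = (1/2) * (((z - 2*\<delta>) / \<delta>)^2 - 1) - ln \<delta>"

definition Bhat :: "real \<Rightarrow> real \<Rightarrow> real" where
  "Bhat \<delta> z = (if z > \<delta> then - ln z else beta2 \<delta> z)"

text \<open>Recentered relaxed barrier for the polytope {x. C x <= d}.
  Flag g = True: gradient recentering (then the weight vector is taken to be 0);
  g = False: weight recentering with weights w.\<close>
definition rbar :: "bool \<Rightarrow> real \<Rightarrow> real^'a^'p \<Rightarrow> real^'p \<Rightarrow> real^'p \<Rightarrow> real^'a \<Rightarrow> real" where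
  "rbar g \<delta> C d w x =
     (if g then (\<Sum>i\<in>UNIV. Bhat \<delta> (d $ i - (C $ i) \<bullet> x) + ln (d $ i) - ((C $ i) \<bullet> x) / d $ i)
      else (\<Sum>i\<in>UNIV. (1 + w $ i) * (Bhat \<delta> (d $ i - (C $ i) \<bullet> x) + ln (d $ i))))"

definition weight_recentered :: "real^'a^'p \<Rightarrow> real^'p \<Rightarrow> real^'p \<Rightarrow> bool" where
  "weight_recentered C d w \<longleftrightarrow>
     (\<forall>i. 0 \<le> w $ i) \<and> (\<Sum>i\<in>UNIV. ((1 + w $ i) / d $ i) *\<^sub>R (C $ i)) = 0"

definition Mmat :: "real \<Rightarrow> real^'a^'p \<Rightarrow> real^'p \<Rightarrow> real^'a^'a" where
  "Mmat \<delta> C w = (1 / (2 * \<delta>^2)) *\<^sub>R (transpose C ** diag_mat (1 + w) ** C)"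

primrec xtraj :: "real^'n^'n \<Rightarrow> real^'m^'n \<Rightarrow> real^'n \<Rightarrow> (nat \<Rightarrow> real^'m) \<Rightarrow> nat \<Rightarrow> real^'n" where
  "xtraj A B x u 0 = x"
| "xtraj A B x u (Suc k) = A *v xtraj A B x u k + B *v u k"

definition lhat ::
  "real^'n^'n \<Rightarrow> real^'m^'m \<Rightarrow> real \<Rightarrow> real \<Rightarrow>
   bool \<Rightarrow> real^'n^'p \<Rightarrow> real^'p \<Rightarrow> real^'p \<Rightarrow>
   bool \<Rightarrow> real^'m^'q \<Rightarrow> real^'q \<Rightarrow> real^'q \<Rightarrow> real^'n \<Rightarrow> real^'m \<Rightarrow> real" where
  "lhat Q R \<epsilon> \<delta> gx Cx dx wx gu Cu du wu x u =
     x \<bullet> (Q *v x) + u \<bullet> (R *v u) + \<epsilon> * rbar gu \<delta> Cu du wu u + \<epsilon> * rbar gx \<delta> Cx dx wx x"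

text \<open>Relaxed MPC cost; only u 0, ..., u (N-1) matter.\<close>
definition relaxed_cost ::
  "real^'n^'n \<Rightarrow> real^'m^'n \<Rightarrow> real^'n^'n \<Rightarrow> real^'m^'m \<Rightarrow> real^'n^'n \<Rightarrow> nat \<Rightarrow> real \<Rightarrow> real \<Rightarrow>
   bool \<Rightarrow> real^'n^'p \<Rightarrow> real^'p \<Rightarrow> real^'p \<Rightarrow>
   bool \<Rightarrow> real^'m^'q \<Rightarrow> real^'q \<Rightarrow> real^'q \<Rightarrow> real^'n \<Rightarrow> (nat \<Rightarrow> real^'m) \<Rightarrow> real" where
  "relaxed_cost A B Q R P N \<epsilon> \<delta> gx Cx dx wx gu Cu du wu x u =
     (\<Sum>k<N. lhat Q R \<epsilon> \<delta> gx Cx dx wx gu Cu du wu (xtraj A B x u k) (u k))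
     + xtraj A B x u N \<bullet> (P *v xtraj A B x u N)"

text \<open>First element of an optimal input sequence (the optimizer is unique in its first N entries
  by strict convexity; SOME picks a minimizer).\<close>
definition mpc_feedback ::
  "real^'n^'n \<Rightarrow> real^'m^'n \<Rightarrow> real^'n^'n \<Rightarrow> real^'m^'m \<Rightarrow> real^'n^'n \<Rightarrow> nat \<Rightarrow> real \<Rightarrow> real \<Rightarrow>
   bool \<Rightarrow> real^'n^'p \<Rightarrow> real^'p \<Rightarrow> real^'p \<Rightarrow>
   bool \<Rightarrow> real^'m^'q \<Rightarrow> real^'q \<Rightarrow> real^'q \<Rightarrow> real^'n \<Rightarrow> real^'m" where
  "mpc_feedback A B Q R P N \<epsilon> \<delta> gx Cx dx wx gu Cu du wu x =
     (SOME u. \<forall>v. relaxed_cost A B Q R P N \<epsilon> \<delta> gx Cx dx wx gu Cu du wu x u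
                 \<le> relaxed_cost A B Q R P N \<epsilon> \<delta> gx Cx dx wx gu Cu du wu x v) 0"

definition asymptotically_stable_origin :: "('a::real_normed_vector \<Rightarrow> 'a) \<Rightarrow> bool" where
  "asymptotically_stable_origin f \<longleftrightarrow>
     (\<forall>e>0. \<exists>d>0. \<forall>x0. norm x0 < d \<longrightarrow> (\<forall>k. norm ((f ^^ k) x0) < e))
     \<and> (\<forall>x0. (\<lambda>k. (f ^^ k) x0) \<longlonglongrightarrow> 0)"

end

theory Submission
  imports Defs "HOL-Computational_Algebra.Fundamental_Theorem_Algebra"
begin

text \<open>
  The relaxed barrier has curvature between 0 and \<open>1 / \<delta>\<^sup>2\<close>, so an admissible recentered barrier is
  squeezed between 0 and the quadratic form of \<open>Mmat\<close>. By the modified Riccati equation the linear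
  feedback \<open>K\<close> therefore makes the terminal cost decrease globally by at least the relaxed stage
  cost, and the optimal cost, which is convex and positive definite, decreases along the
  closed loop by the current stage cost.

  Since \<open>Q\<close> is only semidefinite and the state constraint set may be unbounded, the stage cost need
  not be positive definite in the state, and the descent alone gives only stability, boundedness, and
  inputs and state costs that tend to 0. Every limit point then moves under \<open>A\<close> alone at zero state cost;
  a nonzero one would yield a bounded costate orbit contradicting stabilizability.
\<close>

section \<open>Powers of Schur stable matrices\<close>

text \<open>Once the perturbation stays below a small threshold, the bound
  \<open>c ^ j * norm (s k0) + r / 2\<close> reproduces itself under the recurrence, and its
  geometric part dies out.\<close>

lemma perturbed_contraction_tendsto_0:
  fixes s e :: "nat \<Rightarrow> 'a::real_normed_field"
  assumes rec: "\<And>k. s (Suc k) = a * s k + e k" and a: "norm a < 1" and e: "e \<longlonglongrightarrow> 0"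
  shows "s \<longlonglongrightarrow> 0"
proof (rule LIMSEQ_I)
  fix r :: real assume r: "0 < r"
  define c where "c = norm a"
  have c: "0 \<le> c" "c < 1" using a by (auto simp: c_def)
  have "0 < (1 - c) * (r / 2)" using c r by simp
  from LIMSEQ_D[OF e this] obtain k0 where k0: "\<And>k. k \<ge> k0 \<Longrightarrow> norm (e k) < (1 - c) * (r / 2)"
    by auto
  have bound: "norm (s (k0 + j)) \<le> c ^ j * norm (s k0) + r / 2" for j
  proof (induction j)
    case 0 then show ?case using r by simp
  next
    case (Suc j)
    have "norm (s (k0 + Suc j)) \<le> norm (a * s (k0 + j)) + norm (e (k0 + j))"
      using rec[of "k0 + j"] norm_triangle_ineq by simp
    also have "\<dots> \<le> c * norm (s (k0 + j)) + (1 - c) * (r / 2)"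
      using k0[of "k0 + j"] by (simp add: norm_mult c_def)
    also have "\<dots> \<le> c * (c ^ j * norm (s k0) + r / 2) + (1 - c) * (r / 2)"
      using Suc c by (simp add: mult_left_mono)
    also have "\<dots> = c ^ Suc j * norm (s k0) + r / 2" by (simp add: field_simps)
    finally show ?case .
  qed
  have "(\<lambda>j. c ^ j * norm (s k0)) \<longlonglongrightarrow> 0 * norm (s k0)"
    using c by (intro tendsto_intros LIMSEQ_power_zero) auto
  then have "(\<lambda>j. c ^ j * norm (s k0)) \<longlonglongrightarrow> 0" by simp
  from LIMSEQ_D[OF this, of "r/2"] r obtain j0
    where j0: "\<And>j. j \<ge> j0 \<Longrightarrow> norm (c ^ j * norm (s k0)) < r / 2" by auto
  show "\<exists>no. \<forall>n\<ge>no. norm (s n - 0) < r"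
  proof (intro exI[of _ "k0 + j0"] allI impI)
    fix n assume n: "n \<ge> k0 + j0"
    then have "n = k0 + (n - k0)" "n - k0 \<ge> j0" by auto
    then show "norm (s n - 0) < r" using bound[of "n - k0"] j0[of "n - k0"] by simp
  qed
qed

section \<open>Polynomials in a matrix, acting on a vector\<close>

definition poly_act :: "'a::field^'n^'n \<Rightarrow> 'a poly \<Rightarrow> 'a^'n \<Rightarrow> 'a^'n" where
  "poly_act M p v = (\<Sum>i\<le>degree p. coeff p i *s (((*v) M ^^ i) v))"

lemma poly_act_eq_sum:
  assumes "degree p \<le> n"
  shows "poly_act M p v = (\<Sum>i\<le>n. coeff p i *s (((*v) M ^^ i) v))"
  unfolding poly_act_def using assms
  by (intro sum.mono_neutral_left) (auto simp: coeff_eq_0)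

lemma matrix_funpow_diff:
  fixes M :: "'a::field^'n^'n"
  shows "((*v) M ^^ i) (v - w) = ((*v) M ^^ i) v - ((*v) M ^^ i) w"
  by (induction i) (auto simp: matrix_vector_mult_diff_distrib)

lemma matrix_funpow_scale:
  fixes M :: "'a::field^'n^'n"
  shows "((*v) M ^^ i) (a *s v) = a *s ((*v) M ^^ i) v"
  by (induction i) (auto simp: vector_scalar_commute)

lemma poly_act_diff: "poly_act M p (v - w) = poly_act M p v - poly_act M p w"
  by (simp add: poly_act_def matrix_funpow_diff vec.scale_right_diff_distrib sum_subtractf)

lemma poly_act_scale: "poly_act M p (a *s v) = a *s poly_act M p v"
  by (simp add: poly_act_def matrix_funpow_scale vec.scale_sum_right mult.commute)

lemma poly_act_commute: "poly_act M p (M *v v) = M *v poly_act M p v"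
  by (simp add: poly_act_def vec.linear_sum[OF matrix_vector_mul_linear_gen] vector_scalar_commute
      funpow_swap1)

text \<open>Multiplying by the indeterminate shifts the coefficients, which amounts to starting the
  iteration at \<open>M *v v\<close>. A root factor can therefore be moved from the polynomial into
  the vector.\<close>

lemma poly_act_linear_factor:
  "poly_act M ([:- a, 1:] * q) v = poly_act M q (M *v v - a *s v)"
proof -
  let ?L = "\<lambda>i. ((*v) M ^^ i) v"
  let ?n = "degree q"
  have "degree ([:- a, 1:] * q) \<le> Suc ?n"
    using degree_mult_le[of "[:-a,1:]" q] by simp
  then have "poly_act M ([:- a, 1:] * q) v = (\<Sum>i\<le>Suc ?n. coeff ([:- a, 1:] * q) i *s ?L i)"
    by (rule poly_act_eq_sum)
  also have "\<dots> = (\<Sum>i\<le>Suc ?n. coeff (pCons 0 q) i *s ?L i) - a *s (\<Sum>i\<le>Suc ?n. coeff q i *s ?L i)"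
    by (simp add: vec.scale_sum_right vec.scale_left_diff_distrib sum_subtractf vec.scale_right_distrib algebra_simps
        del: sum.atMost_Suc)
  also have "(\<Sum>i\<le>Suc ?n. coeff q i *s ?L i) = poly_act M q v"
    by (rule poly_act_eq_sum[symmetric]) simp
  also have "(\<Sum>i\<le>Suc ?n. coeff (pCons 0 q) i *s ?L i) = poly_act M q (M *v v)"
    by (subst sum.atMost_Suc_shift) (simp add: poly_act_def funpow_swap1)
  finally show ?thesis by (simp add: poly_act_diff poly_act_scale)
qed

text \<open>There is one more iterate than the dimension of the space. If the iterates are distinct,
  a linear dependence supplies the coefficients; dependence is a property of sets, so a repetition
  is treated apart and gives a difference of two monomials.\<close>

lemma annihilating_poly_exists:
  fixes M :: "'a::field^'n^'n"
  shows "\<exists>p. p \<noteq> 0 \<and> poly_act M p v = 0"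
proof (cases "inj_on (\<lambda>i. ((*v) M ^^ i) v) {..CARD('n)}")
  case True
  let ?f = "\<lambda>i. ((*v) M ^^ i) v"
  have "card (?f ` {..CARD('n)}) = Suc CARD('n)" using True by (simp add: card_image)
  then have "vec.dependent (?f ` {..CARD('n)})"
    using vec.dim_subset_UNIV[of "?f ` {..CARD('n)}"]
    by (intro vec.dependent_biggerset_general) (auto simp: vec.dimension_def card_cart_basis)
  then obtain u where u: "\<exists>x\<in>?f ` {..CARD('n)}. u x \<noteq> 0" "(\<Sum>x\<in>?f ` {..CARD('n)}. u x *s x) = 0"
    by (auto simp: vec.dependent_finite)
  define p where "p = (\<Sum>i\<le>CARD('n). monom (u (?f i)) i)"
  have cf: "coeff p i = (if i \<le> CARD('n) then u (?f i) else 0)" for i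
    by (simp add: p_def coeff_sum)
  have "degree p \<le> CARD('n)" by (rule degree_le) (simp add: cf)
  then have "poly_act M p v = (\<Sum>i\<le>CARD('n). u (?f i) *s ?f i)"
    by (simp add: poly_act_eq_sum cf)
  also have "\<dots> = 0" using u(2) by (simp add: sum.reindex[OF True])
  finally have "poly_act M p v = 0" .
  moreover obtain i where "i \<le> CARD('n)" "u (?f i) \<noteq> 0" using u(1) by auto
  then have "coeff p i \<noteq> 0" by (simp add: cf)
  then have "p \<noteq> 0" by auto
  ultimately show ?thesis by blast
next
  case False
  then obtain i j where ij: "i \<noteq> j" "((*v) M ^^ i) v = ((*v) M ^^ j) v"
    by (auto simp: inj_on_def)
  define p where "p = monom (1::'a) i - monom 1 j"
  have "coeff p i = 1" using ij by (simp add: p_def)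
  then have "p \<noteq> 0" by auto
  have "degree p \<le> max i j" by (rule degree_le) (auto simp: p_def)
  then have "poly_act M p v = (\<Sum>k\<le>max i j. coeff p k *s ((*v) M ^^ k) v)"
    by (rule poly_act_eq_sum)
  also have "\<dots> = (\<Sum>k\<le>max i j. (if i = k then ((*v) M ^^ k) v else 0) - (if j = k then ((*v) M ^^ k) v else 0))"
    by (rule sum.cong) (auto simp: p_def vec.scale_left_diff_distrib)
  also have "\<dots> = 0" using ij by (simp add: sum_subtractf)
  finally show ?thesis using \<open>p \<noteq> 0\<close> by blast
qed

text \<open>Peel off the linear factors of an annihilating polynomial of the vector. A factor with root
  outside the open unit disc acts injectively and can be cancelled; a factor with root
  inside gives a contractive recurrence driven by a sequence that tends to 0.\<close>
lemma annihilated_powers_tendsto_0: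
  fixes M :: "complex^'n^'n"
  assumes spec: "\<And>a v. v \<noteq> 0 \<Longrightarrow> M *v v = a *s v \<Longrightarrow> cmod a < 1"
  shows "p \<noteq> 0 \<Longrightarrow> poly_act M p v = 0 \<Longrightarrow> (\<lambda>k. ((*v) M ^^ k) v) \<longlonglongrightarrow> 0"
proof (induction "degree p" arbitrary: p v)
  case 0
  then obtain c where "p = [:c:]" by (metis degree_eq_zeroE)
  with 0 have "v = 0" by (simp add: poly_act_def)
  then have "((*v) M ^^ k) v = 0" for k by (induction k) auto
  then show ?case by simp
next
  case (Suc n)
  then have "\<not> constant (poly p)" by (simp add: constant_degree)
  then obtain a where "poly p a = 0" using fundamental_theorem_of_algebra by blast
  then obtain q where q: "p = [:-a, 1:] * q" by (auto simp: poly_eq_0_iff_dvd)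
  have "q \<noteq> 0" using Suc.prems q by auto
  then have dq: "n = degree q" using Suc.hyps(2) q degree_mult_eq[of "[:-a,1:]" q] by simp
  have 0: "poly_act M q (M *v v - a *s v) = 0" using Suc.prems q by (simp only: poly_act_linear_factor)
  show ?case
  proof (cases "cmod a < 1")
    case True
    let ?w = "M *v v - a *s v"
    have w: "(\<lambda>k. ((*v) M ^^ k) ?w) \<longlonglongrightarrow> 0" using Suc.hyps(1)[OF dq \<open>q \<noteq> 0\<close> 0] .
    have step: "((*v) M ^^ Suc k) v = a *s ((*v) M ^^ k) v + ((*v) M ^^ k) ?w" for k
      by (simp add: matrix_funpow_diff matrix_funpow_scale funpow_swap1)
    show ?thesis
    proof (rule vec_tendstoI)
      fix i
      show "(\<lambda>k. ((*v) M ^^ k) v $ i) \<longlonglongrightarrow> 0 $ i"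
        unfolding zero_index
        by (rule perturbed_contraction_tendsto_0[OF _ True, where e = "\<lambda>k. ((*v) M ^^ k) ?w $ i"])
          (use step tendsto_vec_nth[OF w, of i] in \<open>auto simp del: funpow.simps\<close>)
    qed
  next
    case False
    have "M *v poly_act M q v = a *s poly_act M q v"
      using 0 by (simp add: poly_act_diff poly_act_scale poly_act_commute)
    then have "poly_act M q v = 0" using spec False by blast
    then show ?thesis using Suc.hyps(1)[OF dq \<open>q \<noteq> 0\<close>] by blast
  qed
qed

text \<open>Schur stability speaks of complex eigenvectors, so the iteration is embedded into
  complex vectors, where polynomials split.\<close>

lemma schur_stable_powers_tendsto_0:
  fixes M :: "real^'n^'n"
  assumes "schur_stable M"
  shows "(\<lambda>k. ((*v) M ^^ k) v) \<longlonglongrightarrow> 0"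
proof -
  define Mc where "Mc = (\<chi> i j. complex_of_real (M $ i $ j))"
  define c where "c = (\<lambda>v::real^'n. \<chi> i. complex_of_real (v $ i))"
  have c: "Mc *v c u = c (M *v u)" for u
    by (simp add: Mc_def c_def matrix_vector_mult_def vec_eq_iff)
  have pow: "((*v) Mc ^^ k) (c v) = c (((*v) M ^^ k) v)" for k
    by (induction k) (auto simp: c)
  obtain p where "p \<noteq> 0" "poly_act Mc p (c v) = 0" using annihilating_poly_exists by blast
  then have "(\<lambda>k. c (((*v) M ^^ k) v)) \<longlonglongrightarrow> 0"
    using annihilated_powers_tendsto_0[of Mc p "c v"] assms unfolding pow
    by (auto simp: schur_stable_def Mc_def)
  then have "(\<lambda>k. c (((*v) M ^^ k) v) $ i) \<longlonglongrightarrow> 0 $ i" for i by (rule tendsto_vec_nth)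
  then have "(\<lambda>k. ((*v) M ^^ k) v $ i) \<longlonglongrightarrow> 0 $ i" for i
    by (simp add: c_def tendsto_of_real_iff[where 'a=complex, of _ 0, simplified])
  then show ?thesis by (rule vec_tendstoI)
qed

section \<open>Quadratic forms and convex functions\<close>

declare transpose_matrix_vector [simp del]

lemma inner_matrix_vector_transpose:
  fixes M :: "real^'a^'b"
  shows "x \<bullet> (M *v y) = (transpose M *v x) \<bullet> y"
  by (simp add: dot_lmul_matrix transpose_matrix_vector)

lemma matrix_mult_minus_right:
  fixes M :: "real^'a^'b" and M' :: "real^'c^'a"
  shows "M ** (- M') = - (M ** M')"
  by (simp add: matrix_matrix_mult_def vec_eq_iff sum_negf)

lemma matrix_vector_mult_minus_left:
  fixes M :: "real^'a^'b"
  shows "(- M) *v x = - (M *v x)"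
  by (simp add: matrix_vector_mult_def vec_eq_iff sum_negf)

lemma matrix_vector_mult_minus_right:
  fixes M :: "real^'a^'b"
  shows "M *v (- x) = - (M *v x)"
  by (simp add: matrix_vector_mult_def vec_eq_iff sum_negf)

lemma quadratic_form_add:
  fixes M :: "real^'n^'n"
  assumes "transpose M = M"
  shows "(x + y) \<bullet> (M *v (x + y)) = x \<bullet> (M *v x) + 2 * (y \<bullet> (M *v x)) + y \<bullet> (M *v y)"
proof -
  have "x \<bullet> (M *v y) = y \<bullet> (M *v x)"
    using assms by (metis inner_commute inner_matrix_vector_transpose)
  then show ?thesis by (simp add: matrix_vector_right_distrib inner_add_left inner_add_right)
qed

lemma quadratic_form_scaleR:
  fixes M :: "real^'n^'n"
  shows "(t *\<^sub>R x) \<bullet> (M *v (t *\<^sub>R x)) = t\<^sup>2 * (x \<bullet> (M *v x))"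
  by (simp add: matrix_vector_mult_scaleR power2_eq_square)

text \<open>A small step from \<open>x\<close> against a nonzero \<open>M *v x\<close> would make
  the form negative, because its first-order term dominates.\<close>

lemma psd_mat_zero_imp_kernel:
  assumes M: "psd_mat M" and 0: "x \<bullet> (M *v x) = 0"
  shows "M *v x = 0"
proof (rule ccontr)
  define y where "y = M *v x"
  assume "M *v x \<noteq> 0"
  then have y: "0 < y \<bullet> y" by (simp add: y_def)
  define b where "b = y \<bullet> (M *v y)"
  have b: "0 \<le> b" using M by (simp add: b_def psd_mat_def)
  \<comment> \<open>This length makes \<open>t * b\<close> at most \<open>y \<bullet> y\<close>;
    adding 1 keeps the denominator positive when \<open>b\<close> is 0.\<close>
  define t where "t = (y \<bullet> y) / (b + 1)"
  have t: "0 < t" using y b by (simp add: t_def)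
  have "0 \<le> (x + (- t) *\<^sub>R y) \<bullet> (M *v (x + (- t) *\<^sub>R y))" using M unfolding psd_mat_def by blast
  also have "\<dots> = t\<^sup>2 * b - 2 * t * (y \<bullet> y)"
    using M 0 unfolding psd_mat_def
    by (subst quadratic_form_add) (simp_all add: matrix_vector_mult_scaleR power2_eq_square y_def b_def
        flip: scaleR_minus_left)
  also have "\<dots> = t * (t * b - 2 * (y \<bullet> y))" by (simp add: power2_eq_square algebra_simps)
  finally have "2 * (y \<bullet> y) \<le> t * b" using t by (simp add: zero_le_mult_iff)
  also have "\<dots> \<le> y \<bullet> y" using b y by (simp add: t_def divide_simps algebra_simps)
  finally show False using y by simp
qed

text \<open>The convexity defect of a symmetric form is \<open>t * (1 - t)\<close> times its value
  at \<open>x - y\<close>.\<close>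

lemma psd_mat_convex:
  assumes M: "psd_mat M"
  shows "convex_on UNIV (\<lambda>x. x \<bullet> (M *v x))"
proof (rule convex_onI)
  fix t :: real and x y assume t: "0 < t" "t < 1"
  have sym: "transpose M = M" using M by (simp add: psd_mat_def)
  have xy: "x \<bullet> (M *v y) = y \<bullet> (M *v x)"
    using sym by (metis inner_commute inner_matrix_vector_transpose)
  have "(1 - t) * (x \<bullet> (M *v x)) + t * (y \<bullet> (M *v y))
      - ((1 - t) *\<^sub>R x + t *\<^sub>R y) \<bullet> (M *v ((1 - t) *\<^sub>R x + t *\<^sub>R y))
      = t * (1 - t) * ((x - y) \<bullet> (M *v (x - y)))"
    by (simp add: matrix_vector_right_distrib matrix_vector_mult_diff_distrib matrix_vector_mult_scaleR
        inner_add_left inner_add_right inner_diff_left inner_diff_right xy algebra_simps)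
  also have "\<dots> \<ge> 0" using M t by (simp add: psd_mat_def)
  finally show "((1 - t) *\<^sub>R x + t *\<^sub>R y) \<bullet> (M *v ((1 - t) *\<^sub>R x + t *\<^sub>R y))
    \<le> (1 - t) * (x \<bullet> (M *v x)) + t * (y \<bullet> (M *v y))" by simp
qed simp

lemma pd_imp_psd: "pd_mat M \<Longrightarrow> psd_mat M"
  unfolding pd_mat_def psd_mat_def by (metis inner_zero_left less_eq_real_def)

lemma continuous_on_quadratic_form:
  fixes M :: "real^'n^'n"
  shows "continuous_on S (\<lambda>x. x \<bullet> (M *v x))"
  by (intro continuous_intros linear_continuous_on) (simp add: linear_linear)

lemma pd_mat_lower_bound:
  fixes M :: "real^'n^'n"
  assumes "pd_mat M"
  shows "\<exists>c>0. \<forall>x. c * (norm x)\<^sup>2 \<le> x \<bullet> (M *v x)"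
proof -
  have "\<exists>y\<in>sphere 0 1. \<forall>x\<in>sphere 0 1. y \<bullet> (M *v y) \<le> x \<bullet> (M *v x)"
    by (intro continuous_attains_inf continuous_on_quadratic_form) auto
  then obtain y where y: "norm y = 1" "\<And>x. norm x = 1 \<Longrightarrow> y \<bullet> (M *v y) \<le> x \<bullet> (M *v x)"
    by auto
  show ?thesis
  proof (intro exI[of _ "y \<bullet> (M *v y)"] conjI allI)
    have "y \<noteq> 0" using y(1) by auto
    then show "0 < y \<bullet> (M *v y)" using assms by (simp add: pd_mat_def)
    fix x :: "real^'n"
    show "y \<bullet> (M *v y) * (norm x)\<^sup>2 \<le> x \<bullet> (M *v x)"
    proof (cases "x = 0")
      case False
      define z where "z = (1 / norm x) *\<^sub>R x"
      have z: "x = norm x *\<^sub>R z" "norm z = 1" using False by (auto simp: z_def)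
      have "x \<bullet> (M *v x) = (norm x)\<^sup>2 * (z \<bullet> (M *v z))"
        by (metis quadratic_form_scaleR z(1))
      then show ?thesis using y(2)[OF z(2)] by (simp add: mult.commute mult_right_mono)
    qed simp
  qed
qed

lemma pd_mat_invertible:
  assumes "pd_mat M"
  shows "invertible M"
proof -
  have "x = 0" if "M *v x = 0" for x
    using assms that unfolding pd_mat_def by (metis inner_zero_right less_irrefl)
  then show ?thesis
    by (simp add: invertible_left_inverse matrix_left_invertible_ker)
qed

lemma matrix_inv_right_inverse:
  fixes M :: "real^'n^'n"
  assumes "invertible M"
  shows "M ** matrix_inv M = mat 1"
  using assms unfolding invertible_def matrix_inv_def by (metis (mono_tags, lifting) someI_ex)

lemma coercive_attains_min:
  fixes f :: "'a::euclidean_space \<Rightarrow> real"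
  assumes cont: "continuous_on UNIV f" and c: "0 < c" and low: "\<And>x. c * (norm x)\<^sup>2 \<le> f x"
  shows "\<exists>x. \<forall>y. f x \<le> f y"
proof -
  \<comment> \<open>Then \<open>c * r\<close> exceeds \<open>f 0\<close>, and
    \<open>r \<ge> 1\<close> gives \<open>r \<le> (norm y)\<^sup>2\<close> outside the ball, so the
    values of \<open>f\<close> there exceed \<open>f 0\<close>.\<close>
  define r where "r = 1 + f 0 / c"
  have f0: "0 \<le> f 0" using low[of 0] by simp
  then have r: "1 \<le> r" using c by (simp add: r_def)
  have "\<exists>x\<in>cball 0 r. \<forall>y\<in>cball 0 r. f x \<le> f y"
    using r by (intro continuous_attains_inf continuous_on_subset[OF cont]) auto
  then obtain x where x: "\<And>y. norm y \<le> r \<Longrightarrow> f x \<le> f y"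
    by (auto simp: Ball_def)
  have "f x \<le> f y" for y
  proof (cases "norm y \<le> r")
    case False
    have "f x \<le> f 0" using x[of 0] r by simp
    also have "\<dots> \<le> c * r" using c by (simp add: r_def field_simps)
    also have "\<dots> \<le> c * (norm y)\<^sup>2"
    proof -
      have "r * 1 \<le> norm y * norm y" using False r by (intro mult_mono) auto
      then show ?thesis using c by (simp add: power2_eq_square)
    qed
    also have "\<dots> \<le> f y" by (rule low)
    finally show ?thesis .
  qed (use x in blast)
  then show ?thesis by blast
qed

text \<open>Along each ray from the origin, convexity and \<open>V 0 = 0\<close> make
  \<open>V x / norm x\<close> nondecreasing, so the minimum over the sphere of radius
  \<open>e\<close> fixes a slope valid outside it.\<close>

lemma convex_positive_definite_lower_bound:
  fixes V :: "'a::euclidean_space \<Rightarrow> real"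
  assumes conv: "convex_on UNIV V" and 0: "V 0 = 0" and pos: "\<And>x. x \<noteq> 0 \<Longrightarrow> 0 < V x"
    and e: "0 < e"
  shows "\<exists>m>0. \<forall>x. e \<le> norm x \<longrightarrow> m * norm x \<le> V x"
proof -
  have "continuous_on UNIV V" using conv by (intro convex_on_continuous) auto
  then have "continuous_on (sphere 0 e) V" by (rule continuous_on_subset) simp
  moreover have "sphere (0::'a) e \<noteq> {}" using e by simp
  ultimately have "\<exists>y\<in>sphere 0 e. \<forall>x\<in>sphere 0 e. V y \<le> V x"
    by (intro continuous_attains_inf) simp_all
  then obtain y where y: "norm y = e" "\<And>x. norm x = e \<Longrightarrow> V y \<le> V x" by auto
  have Vy: "0 < V y" using pos y e by auto
  show ?thesis
  proof (intro exI[of _ "V y / e"] conjI allI impI)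
    fix x :: 'a assume x: "e \<le> norm x"
    define t where "t = e / norm x"
    have nx: "0 < norm x" using x e by linarith
    have t: "0 \<le> t" "t \<le> 1" using x e nx by (auto simp: t_def)
    have "norm (t *\<^sub>R x) = e" using nx e by (simp add: t_def)
    then have "V y \<le> V (t *\<^sub>R x)" by (rule y(2))
    also have "\<dots> \<le> t * V x" using convex_onD[OF conv t, of 0 x] 0 by simp
    finally show "V y / e * norm x \<le> V x" using nx e by (simp add: t_def field_simps)
  qed (use Vy e in simp)
qed

section \<open>Receding horizon control with a Riccati terminal cost\<close>

lemma xtraj_Suc_shift:
  "xtraj A B x u (Suc k) = xtraj A B (A *v x + B *v u 0) (\<lambda>i. u (Suc i)) k"
  by (induction k) auto

lemma xtraj_cong:
  assumes "\<And>i. i < k \<Longrightarrow> u i = v i"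
  shows "xtraj A B x u k = xtraj A B x v k"
  using assms by (induction k) auto

text \<open>Intended for \<open>hx\<close> and \<open>hu\<close> the state and input costs with
  their barriers, and for \<open>Q\<close> and \<open>R\<close> enlarged by the barrier matrices.
  \<open>hx_zero\<close> removes \<open>Q\<close> from the Riccati equation at states of zero
  cost.\<close>

locale riccati_mpc =
  fixes A :: "real^'n^'n" and B :: "real^'m^'n" and P Q :: "real^'n^'n" and R :: "real^'m^'m"
    and K :: "real^'n^'m" and hx :: "real^'n \<Rightarrow> real" and hu :: "real^'m \<Rightarrow> real" and c :: real
  assumes stab: "stabilizable A B"
    and P_pd: "pd_mat P" and R_pd: "pd_mat R"
    and K_eq: "K = - (matrix_inv (R + transpose B ** P ** B) ** transpose B ** P ** A)"
    and P_eq: "P = transpose (A + B ** K) ** P ** (A + B ** K) + transpose K ** R ** K + Q"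
    and hx_convex: "convex_on UNIV hx" and hx_0: "hx 0 = 0" and hx_nonneg: "0 \<le> hx x"
    and hx_le: "hx x \<le> x \<bullet> (Q *v x)" and hx_zero: "hx x = 0 \<Longrightarrow> Q *v x = 0"
    and hu_convex: "convex_on UNIV hu" and hu_0: "hu 0 = 0"
    and c_pos: "0 < c" and hu_ge: "c * (norm u)\<^sup>2 \<le> hu u" and hu_le: "hu u \<le> u \<bullet> (R *v u)"
begin

definition cost :: "nat \<Rightarrow> real^'n \<Rightarrow> (nat \<Rightarrow> real^'m) \<Rightarrow> real" where
  "cost N x u = (\<Sum>k<N. hx (xtraj A B x u k) + hu (u k))
     + xtraj A B x u N \<bullet> (P *v xtraj A B x u N)"

section \<open>Consequences of the Riccati equation\<close>

definition S :: "real^'m^'m" where "S = R + transpose B ** P ** B"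

lemma P_sym: "transpose P = P" using P_pd by (simp add: pd_mat_def)
lemma R_sym: "transpose R = R" using R_pd by (simp add: pd_mat_def)

lemma P_pos: "x \<noteq> 0 \<Longrightarrow> 0 < x \<bullet> (P *v x)" using P_pd by (simp add: pd_mat_def)
lemma P_nonneg: "0 \<le> x \<bullet> (P *v x)" using pd_imp_psd[OF P_pd] by (simp add: psd_mat_def)

lemma S_form: "u \<bullet> (S *v v) = u \<bullet> (R *v v) + (B *v u) \<bullet> (P *v (B *v v))"
  by (simp add: S_def matrix_vector_mult_add_rdistrib inner_add_right
      inner_matrix_vector_transpose[of u "transpose B"] flip: matrix_vector_mul_assoc)

lemma S_pd: "pd_mat S"
proof -
  have "transpose (transpose B ** P ** B) = transpose B ** P ** B"
    by (simp add: matrix_transpose_mul P_sym matrix_mul_assoc)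
  then have "transpose S = S"
    using R_sym by (simp add: S_def transpose_def vec_eq_iff)
  then show ?thesis
    using R_pd P_nonneg by (simp add: pd_mat_def S_form add_pos_nonneg)
qed

lemma hu_nonneg: "0 \<le> hu u"
  using hu_ge[of u] c_pos by (meson order_trans mult_nonneg_nonneg less_imp_le zero_le_power2)

text \<open>Cleared of its inverse, the gain formula is the stationarity condition in
  \<open>u\<close> of the one-step quadratic problem.\<close>

lemma gain_eq: "S *v (K *v x) = - (transpose B *v (P *v (A *v x)))"
proof -
  have "S ** K = - (S ** matrix_inv S ** transpose B ** P ** A)"
    by (subst K_eq) (simp add: S_def[symmetric] matrix_mul_assoc matrix_mult_minus_right)
  also have "\<dots> = - (transpose B ** P ** A)"
    by (simp add: matrix_inv_right_inverse pd_mat_invertible[OF S_pd])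
  finally show ?thesis
    by (simp add: matrix_vector_mul_assoc matrix_mul_assoc matrix_vector_mult_minus_left)
qed

lemma P_apply:
  "P *v x = transpose (A + B ** K) *v (P *v (A *v x + B *v (K *v x)))
     + transpose K *v (R *v (K *v x)) + Q *v x"
  by (subst P_eq) (simp add: matrix_vector_mult_add_rdistrib flip: matrix_vector_mul_assoc)

text \<open>Completion of squares: the Riccati equation makes the cross terms vanish.\<close>
lemma riccati_completion:
  "(A *v x + B *v u) \<bullet> (P *v (A *v x + B *v u)) + u \<bullet> (R *v u) + x \<bullet> (Q *v x)
     = x \<bullet> (P *v x) + (u - K *v x) \<bullet> (S *v (u - K *v x))"
proof -
  define v y k where "v = u - K *v x" and "y = A *v x + B *v (K *v x)" and "k = K *v x"
  have u: "u = k + v" by (simp add: v_def k_def)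
  have cross: "(B *v v) \<bullet> (P *v y) + v \<bullet> (R *v k) = 0"
  proof -
    have "(B *v v) \<bullet> (P *v y) + v \<bullet> (R *v k) = v \<bullet> (transpose B *v (P *v (A *v x))) + v \<bullet> (S *v k)"
      by (simp add: S_form y_def k_def inner_matrix_vector_transpose[of v "transpose B"]
          matrix_vector_right_distrib inner_add_right)
    also have "\<dots> = 0" by (simp add: k_def gain_eq)
    finally show ?thesis .
  qed
  have "x \<bullet> (P *v x) = y \<bullet> (P *v y) + k \<bullet> (R *v k) + x \<bullet> (Q *v x)"
    by (subst P_apply) (simp add: inner_add_right y_def k_def
        inner_matrix_vector_transpose[of x "transpose _"] matrix_vector_mult_add_rdistrib
        flip: matrix_vector_mul_assoc)
  moreover have "A *v x + B *v u = y + B *v v"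
    by (simp add: y_def v_def matrix_vector_mult_diff_distrib)
  ultimately show ?thesis
    using cross unfolding v_def[symmetric]
    by (simp add: u quadratic_form_add[OF P_sym] quadratic_form_add[OF R_sym] S_form)
qed

text \<open>With \<open>u = K *v x\<close> the residual square vanishes, and the quadratic forms
  dominate \<open>hx\<close> and \<open>hu\<close> on the whole space.\<close>

lemma terminal_decrease:
  "hx x + hu (K *v x) + (A *v x + B *v (K *v x)) \<bullet> (P *v (A *v x + B *v (K *v x))) \<le> x \<bullet> (P *v x)"
  using riccati_completion[of x "K *v x"] hx_le[of x] hu_le[of "K *v x"] by simp

text \<open>Completion of squares at \<open>u = 0\<close>: zero state cost deletes the
  \<open>Q\<close> term, and the residual is the square of the feedback that was not
  applied.\<close>

lemma P_form_free_motion: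
  assumes "hx x = 0"
  shows "(A *v x) \<bullet> (P *v (A *v x)) = x \<bullet> (P *v x) + (K *v x) \<bullet> (S *v (K *v x))"
  using riccati_completion[of x 0] hx_zero[OF assms]
  by (simp add: matrix_vector_mult_minus_right)

lemma P_form_le_free_motion:
  assumes "hx x = 0"
  shows "x \<bullet> (P *v x) \<le> (A *v x) \<bullet> (P *v (A *v x))"
  using P_form_free_motion[OF assms] pd_imp_psd[OF S_pd] by (simp add: psd_mat_def)

text \<open>With \<open>K *v x = 0\<close>, \<open>gain_eq\<close> yields the second identity. It
  removes the \<open>K\<close> terms from the Riccati equation, so \<open>transpose A\<close>
  carries the costate \<open>P *v x\<close> backward along the free motion.\<close>

lemma costate_recursion:
  assumes "hx x = 0" "K *v x = 0"
  shows "transpose A *v (P *v (A *v x)) = P *v x" "transpose B *v (P *v (A *v x)) = 0"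
proof -
  show *: "transpose B *v (P *v (A *v x)) = 0" using gain_eq[of x] assms by simp
  have "transpose (A + B ** K) = transpose A + transpose K ** transpose B"
    by (simp add: vec_eq_iff transpose_def flip: matrix_transpose_mul[unfolded transpose_def])
  then show "transpose A *v (P *v (A *v x)) = P *v x"
    using P_apply[of x] assms hx_zero[OF assms(1)] *
    by (simp add: matrix_vector_mult_add_rdistrib flip: matrix_vector_mul_assoc)
qed

section \<open>Dynamic programming and the optimal cost\<close>

lemma cost_Suc:
  "cost (Suc N) x u = hx x + hu (u 0) + cost N (A *v x + B *v u 0) (\<lambda>i. u (Suc i))"
  unfolding cost_def sum.lessThan_Suc_shift xtraj_Suc_shift by simp

text \<open>Bellman recursion: the next value function minimises, over the first input, the stage
  cost plus the old value at the successor. The minimum exists since \<open>hu\<close> is coercive,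
  and partial minimisation of a jointly convex function is convex.\<close>

lemma value_function_exists:
  "\<exists>V. convex_on UNIV V \<and> (\<forall>x. 0 \<le> V x) \<and> (\<forall>x u. V x \<le> cost N x u) \<and> (\<forall>x. \<exists>u. cost N x u = V x)"
proof (induction N)
  case 0
  show ?case
    using psd_mat_convex[OF pd_imp_psd[OF P_pd]] P_nonneg
    by (intro exI[of _ "\<lambda>x. x \<bullet> (P *v x)"]) (simp add: cost_def)
next
  case (Suc N)
  then obtain V where V: "convex_on UNIV V" "\<And>x. 0 \<le> V x" "\<And>x u. V x \<le> cost N x u"
    and att: "\<And>x. \<exists>u. cost N x u = V x" by blast
  define G where "G x u = hx x + hu u + V (A *v x + B *v u)" for x u
  have contV: "continuous_on UNIV V" and conthu: "continuous_on UNIV hu"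
    using V(1) hu_convex by (auto intro!: convex_on_continuous)
  have "\<exists>u. \<forall>v. G x u \<le> G x v" for x
  proof (rule coercive_attains_min[OF _ c_pos])
    show "continuous_on UNIV (G x)"
      unfolding G_def
      by (intro continuous_intros conthu continuous_on_compose2[OF contV] linear_continuous_on)
        (auto simp: linear_linear)
    show "c * (norm u)\<^sup>2 \<le> G x u" for u
      using hu_ge[of u] hx_nonneg[of x] V(2)[of "A *v x + B *v u"] by (simp add: G_def)
  qed
  then obtain m where m: "\<And>x v. G x (m x) \<le> G x v" by metis
  define W where "W x = G x (m x)" for x
  have "convex_on UNIV W"
  proof (rule convex_onI)
    fix t :: real and x y assume t: "0 < t" "t < 1"
    \<comment> \<open>The convex combination of the two minimisers serves as a candidate input at
      \<open>?z\<close>.\<close>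
    let ?z = "(1 - t) *\<^sub>R x + t *\<^sub>R y" and ?u = "(1 - t) *\<^sub>R m x + t *\<^sub>R m y"
    have "A *v ?z + B *v ?u = (1 - t) *\<^sub>R (A *v x + B *v m x) + t *\<^sub>R (A *v y + B *v m y)"
      by (simp add: matrix_vector_right_distrib matrix_vector_mult_scaleR algebra_simps)
    then have "V (A *v ?z + B *v ?u) \<le> (1 - t) * V (A *v x + B *v m x) + t * V (A *v y + B *v m y)"
      using convex_onD[OF V(1)] t by simp
    moreover have "hx ?z \<le> (1 - t) * hx x + t * hx y" using convex_onD[OF hx_convex] t by simp
    moreover have "hu ?u \<le> (1 - t) * hu (m x) + t * hu (m y)" using convex_onD[OF hu_convex] t by simp
    ultimately have "G ?z ?u \<le> (1 - t) * W x + t * W y"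
      by (simp add: G_def W_def algebra_simps)
    then show "W ?z \<le> (1 - t) * W x + t * W y" using m[of ?z ?u] by (simp add: W_def)
  qed simp
  moreover have "0 \<le> W x" for x
    using hx_nonneg hu_nonneg V(2) by (simp add: W_def G_def)
  moreover have "W x \<le> cost (Suc N) x u" for x u
    using m[of x "u 0"] V(3)[of "A *v x + B *v u 0" "\<lambda>i. u (Suc i)"] by (simp add: W_def G_def cost_Suc)
  moreover have "\<exists>u. cost (Suc N) x u = W x" for x
  proof -
    obtain u where "cost N (A *v x + B *v m x) u = V (A *v x + B *v m x)" using att by blast
    then have "cost (Suc N) x (case_nat (m x) u) = W x" by (simp add: cost_Suc W_def G_def)
    then show ?thesis by blast
  qed
  ultimately show ?case by blast
qed

definition opt_cost :: "nat \<Rightarrow> real^'n \<Rightarrow> real" where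
  "opt_cost N x = (INF u. cost N x u)"

lemma opt_cost:
  shows opt_cost_convex: "convex_on UNIV (opt_cost N)"
    and opt_cost_nonneg: "0 \<le> opt_cost N x"
    and opt_cost_le: "opt_cost N x \<le> cost N x u"
    and opt_cost_attained: "\<exists>u. cost N x u = opt_cost N x"
proof -
  obtain V where V: "convex_on UNIV V" "\<And>x. 0 \<le> V x" "\<And>x u. V x \<le> cost N x u"
    and att: "\<And>x. \<exists>u. cost N x u = V x" using value_function_exists[of N] by blast
  have "opt_cost N x = V x" for x
    unfolding opt_cost_def using V(3)[of x] att[of x]
    by (intro cInf_eq_minimum) (auto simp: image_iff, metis)
  then have "opt_cost N = V" by blast
  then show "convex_on UNIV (opt_cost N)" "0 \<le> opt_cost N x" "opt_cost N x \<le> cost N x u"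
    "\<exists>u. cost N x u = opt_cost N x" using V att by auto
qed

text \<open>A sequence optimal for horizon \<open>N\<close>, extended by the feedback
  \<open>K\<close> at its final state, costs no more by \<open>terminal_decrease\<close>.\<close>

lemma opt_cost_antimono: "opt_cost (Suc N) x \<le> opt_cost N x"
proof -
  obtain u where u: "cost N x u = opt_cost N x" using opt_cost_attained by blast
  define v where "v = u(N := K *v xtraj A B x u N)"
  have tr: "xtraj A B x v k = xtraj A B x u k" if "k \<le> N" for k
    using that by (intro xtraj_cong) (auto simp: v_def)
  have "(\<Sum>k<N. hx (xtraj A B x v k) + hu (v k)) = (\<Sum>k<N. hx (xtraj A B x u k) + hu (u k))"
    by (intro sum.cong) (auto simp: tr, simp add: v_def)
  then have "cost (Suc N) x v \<le> cost N x u"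
    using terminal_decrease[of "xtraj A B x u N"] by (simp add: cost_def tr, simp add: v_def)
  then show ?thesis using opt_cost_le[of "Suc N" x v] u by simp
qed

lemma opt_cost_0: "opt_cost N 0 = 0"
proof -
  have "xtraj A B 0 (\<lambda>_. 0) k = 0" for k by (induction k) auto
  then have "cost N 0 (\<lambda>_. 0) = 0" by (simp add: cost_def hx_0 hu_0)
  then show ?thesis using opt_cost_le[of N 0 "\<lambda>_. 0"] opt_cost_nonneg[of N 0] by simp
qed

text \<open>Zero cost would force zero inputs and zero state costs along the way. The free motion
  then cannot decrease the \<open>P\<close> form, so the terminal cost would be at least its
  positive value at \<open>x\<close>.\<close>

lemma opt_cost_pos:
  assumes "x \<noteq> 0"
  shows "0 < opt_cost N x"
proof (rule ccontr)
  assume "\<not> 0 < opt_cost N x"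
  then have "opt_cost N x = 0" using opt_cost_nonneg[of N x] by simp
  moreover obtain u where "cost N x u = opt_cost N x" using opt_cost_attained by blast
  ultimately have 0: "cost N x u = 0" by simp
  let ?x = "xtraj A B x u"
  have nn: "0 \<le> (\<Sum>k<N. hx (?x k) + hu (u k))" using hx_nonneg hu_nonneg by (simp add: sum_nonneg)
  have N0: "?x N \<bullet> (P *v ?x N) = 0" and s0: "(\<Sum>k<N. hx (?x k) + hu (u k)) = 0"
    using 0 nn P_nonneg[of "?x N"] by (simp_all add: cost_def)
  have stage: "hx (?x k) = 0 \<and> u k = 0" if "k < N" for k
  proof -
    have "hx (?x k) + hu (u k) = 0"
      using s0 hx_nonneg hu_nonneg that by (simp add: sum_nonneg_eq_0_iff)
    then have "hx (?x k) = 0" "hu (u k) = 0"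
      using hx_nonneg[of "?x k"] hu_nonneg[of "u k"] by simp_all
    then show ?thesis using hu_ge[of "u k"] c_pos by (auto simp: mult_le_0_iff)
  qed
  have "x \<bullet> (P *v x) \<le> ?x k \<bullet> (P *v ?x k)" if "k \<le> N" for k
    using that
  proof (induction k)
    case (Suc k)
    then show ?case using stage[of k] P_form_le_free_motion[of "?x k"] by simp
  qed simp
  from this[of N] N0 P_pos[OF assms] show False by simp
qed

text \<open>Among the limit points of the sequence pick one, \<open>y\<close>, maximising \<open>x \<bullet> (P *v x)\<close>. Limit points
  are mapped to limit points by \<open>A\<close>, and on them the free motion does not decrease that form, so it
  is constant along the orbit of \<open>y\<close> and \<open>K\<close> vanishes there. The costates \<open>P *v y\<^sub>i\<close>
  are then a bounded backward orbit of the transpose of every \<open>A + B ** L\<close>, and stabilizability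
  forces them to be 0.\<close>
lemma vanishing_stage_cost_imp_tendsto_0:
  assumes rec: "\<And>k. xs (Suc k) = A *v xs k + B *v us k"
    and us: "us \<longlonglongrightarrow> 0" and out: "(\<lambda>k. hx (xs k)) \<longlonglongrightarrow> 0" and bdd: "bounded (range xs)"
  shows "xs \<longlonglongrightarrow> 0"
proof (rule ccontr)
  assume notlim: "\<not> xs \<longlonglongrightarrow> 0"
  \<comment> \<open>The omega-limit set of the sequence, compact by boundedness.\<close>
  define Om where "Om = (\<Inter>n. closure (xs ` {n..}))"
  have Om_iff: "y \<in> Om \<longleftrightarrow> (\<forall>n. \<forall>e>0. \<exists>k\<ge>n. dist (xs k) y < e)" for y
    by (auto simp: Om_def closure_approachable)
  have "Om \<subseteq> closure (range xs)" unfolding Om_def by (auto intro: closure_mono[THEN subsetD, rotated])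
  then have "bounded Om" using bdd bounded_subset bounded_closure by blast
  moreover have "closed Om" by (auto simp: Om_def)
  ultimately have comp: "compact Om" by (simp add: compact_eq_bounded_closed)
  have AOm: "A *v y \<in> Om" if y: "y \<in> Om" for y
    unfolding Om_iff
  proof (intro allI impI)
    fix n and e :: real assume e: "0 < e"
    have "continuous (at y) ((*v) A)" by (simp add: linear_continuous_at linear_linear)
    then obtain d where d: "0 < d" "\<And>z. dist z y < d \<Longrightarrow> dist (A *v z) (A *v y) < e / 2"
      using e unfolding continuous_at_eps_delta by (metis half_gt_zero)
    have "(\<lambda>k. B *v us k) \<longlonglongrightarrow> B *v 0"
      by (intro bounded_linear.tendsto[OF _ us]) (simp add: linear_linear)
    then have "\<forall>\<^sub>F k in sequentially. dist (B *v us k) 0 < e / 2"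
      using e by (intro tendstoD) auto
    then obtain k0 where k0: "\<And>k. k \<ge> k0 \<Longrightarrow> norm (B *v us k) < e / 2"
      by (auto simp: eventually_sequentially)
    obtain k where k: "k \<ge> max n k0" "dist (xs k) y < d" using y d(1) unfolding Om_iff by blast
    have "dist (xs (Suc k)) (A *v y) \<le> dist (A *v xs k) (A *v y) + norm (B *v us k)"
      unfolding rec dist_norm by (metis add.commute add_diff_eq norm_triangle_ineq)
    also have "\<dots> < e" using d(2)[OF k(2)] k0[of k] k(1) by simp
    finally show "\<exists>k\<ge>n. dist (xs k) (A *v y) < e" using k(1) by (intro exI[of _ "Suc k"]) auto
  qed
  have hxOm: "hx y = 0" if y: "y \<in> Om" for y
  proof (rule ccontr)
    assume "hx y \<noteq> 0"
    then have e: "0 < hx y / 2" using hx_nonneg[of y] by simp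
    have "continuous (at y) hx"
      using convex_on_continuous[OF open_UNIV hx_convex] by (simp add: continuous_on_eq_continuous_at)
    then obtain d where d: "0 < d" "\<And>z. dist z y < d \<Longrightarrow> dist (hx z) (hx y) < hx y / 2"
      using e unfolding continuous_at_eps_delta by metis
    from LIMSEQ_D[OF out e] obtain k0 where k0: "\<And>k. k \<ge> k0 \<Longrightarrow> norm (hx (xs k)) < hx y / 2"
      by auto
    obtain k where k: "k \<ge> k0" "dist (xs k) y < d" using y d(1) unfolding Om_iff by blast
    from k0[OF k(1)] d(2)[OF k(2)] show False by (auto simp: dist_real_def abs_if split: if_splits)
  qed
  \<comment> \<open>Failure of convergence leaves infinitely many terms away from 0; by boundedness
    a subsequence of them converges, and its limit is nonzero.\<close>
  have "\<exists>y\<in>Om. y \<noteq> 0"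
  proof -
    obtain e where e: "0 < e" "\<And>n. \<exists>k\<ge>n. e \<le> norm (xs k)"
      using notlim by (auto simp: LIMSEQ_iff not_less)
    then have "infinite {k. e \<le> norm (xs k)}"
      by (auto simp: infinite_nat_iff_unbounded_le)
    then obtain r :: "nat \<Rightarrow> nat" where r: "strict_mono r" "\<And>k. e \<le> norm (xs (r k))"
      using infinite_enumerate by blast
    have "bounded (range (xs \<circ> r))" using bdd by (rule bounded_subset) auto
    then obtain y r' where r': "strict_mono r'" "((xs \<circ> r) \<circ> r') \<longlonglongrightarrow> y"
      using bounded_imp_convergent_subsequence by blast
    have "y \<in> Om"
      unfolding Om_iff
    proof (intro allI impI)
      fix n and e :: real assume "0 < e"
      with r'(2) obtain k0 where k0: "\<And>k. k \<ge> k0 \<Longrightarrow> dist (((xs \<circ> r) \<circ> r') k) y < e"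
        unfolding lim_sequentially by blast
      have "n \<le> r (r' (max n k0))"
        using seq_suble[OF r(1)] seq_suble[OF r'(1)] by (meson max.cobounded1 order_trans)
      then show "\<exists>k\<ge>n. dist (xs k) y < e" using k0[of "max n k0"] by auto
    qed
    moreover have "e \<le> norm y"
      using tendsto_norm[OF r'(2)] r(2) by (intro tendsto_lowerbound[of "\<lambda>k. norm (((xs \<circ> r) \<circ> r') k)"]) auto
    ultimately show ?thesis using e(1) by (intro bexI[of _ y]) auto
  qed
  then obtain y0 where y0: "y0 \<in> Om" "y0 \<noteq> 0" by blast
  then obtain y where y: "y \<in> Om" "\<And>z. z \<in> Om \<Longrightarrow> z \<bullet> (P *v z) \<le> y \<bullet> (P *v y)"
    using continuous_attains_sup[OF comp _ continuous_on_quadratic_form[of Om P]] by blast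
  have "y \<noteq> 0" using y(2)[OF y0(1)] P_pos[OF y0(2)] by auto
  define ys where "ys i = ((*v) A ^^ i) y" for i
  have ys_Suc: "ys (Suc i) = A *v ys i" and ys_0: "ys 0 = y" for i by (simp_all add: ys_def)
  have ysOm: "ys i \<in> Om" for i by (induction i) (auto simp: ys_Suc ys_0 y AOm)
  have const: "ys i \<bullet> (P *v ys i) = y \<bullet> (P *v y)" for i
  proof (induction i)
    case (Suc i)
    then show ?case
      using P_form_le_free_motion[OF hxOm[OF ysOm[of i]]] y(2)[OF ysOm[of "Suc i"]] by (simp add: ys_Suc)
  qed (simp add: ys_0)
  \<comment> \<open>Constancy of the form forces the increment in \<open>P_form_free_motion\<close>
    to be 0, and \<open>S\<close> is positive definite.\<close>
  have Kys: "K *v ys i = 0" for i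
    using P_form_free_motion[OF hxOm[OF ysOm[of i]]] const[of i] const[of "Suc i"] S_pd
    by (auto simp: ys_Suc pd_mat_def)
  obtain L where L: "schur_stable (A + B ** L)" using stab by (auto simp: stabilizable_def)
  define AL where "AL = A + B ** L"
  \<comment> \<open>Moving \<open>z\<close> forward by \<open>AL\<close> while the costate advances
    along \<open>ys\<close> conserves their inner product. The first factor tends to 0 and the
    second is bounded, so the product is 0.\<close>
  have pairing: "z \<bullet> (P *v y) = ((*v) AL ^^ i) z \<bullet> (P *v ys i)" for z i
  proof (induction i)
    case (Suc i)
    define w where "w = ((*v) AL ^^ i) z"
    have "(AL *v w) \<bullet> (P *v ys (Suc i))
      = w \<bullet> (transpose A *v (P *v (A *v ys i))) + (L *v w) \<bullet> (transpose B *v (P *v (A *v ys i)))"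
      by (simp add: AL_def ys_Suc matrix_vector_mult_add_rdistrib inner_add_left
          inner_matrix_vector_transpose[of _ "transpose _"] flip: matrix_vector_mul_assoc)
    also have "\<dots> = w \<bullet> (P *v ys i)" using costate_recursion[OF hxOm[OF ysOm] Kys, of i] by simp
    finally show ?case using Suc by (simp add: w_def)
  qed (simp add: ys_0)
  have "bounded ((*v) P ` Om)"
    by (intro compact_imp_bounded compact_continuous_image comp linear_continuous_on) (simp add: linear_linear)
  then obtain b where b: "\<And>i. norm (P *v ys i) \<le> b" using ysOm by (auto simp: bounded_iff)
  have "z \<bullet> (P *v y) = 0" for z
  proof -
    have "(\<lambda>i. norm (((*v) AL ^^ i) z) * b) \<longlonglongrightarrow> 0 * b"
      using schur_stable_powers_tendsto_0[OF L, of z] unfolding AL_def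
      by (intro tendsto_intros) (simp add: tendsto_norm_zero)
    then have lim: "(\<lambda>i. norm (((*v) AL ^^ i) z) * b) \<longlonglongrightarrow> 0" by simp
    have "\<bar>z \<bullet> (P *v y)\<bar> \<le> norm (((*v) AL ^^ i) z) * b" for i
      unfolding pairing[of z i]
      using Cauchy_Schwarz_ineq2[of "((*v) AL ^^ i) z" "P *v ys i"] mult_left_mono[OF b[of i]]
      by (meson norm_ge_zero order_trans)
    then have "\<bar>z \<bullet> (P *v y)\<bar> \<le> 0" by (intro LIMSEQ_le_const[OF lim]) auto
    then show ?thesis by simp
  qed
  with P_pos[OF \<open>y \<noteq> 0\<close>] show False by simp
qed

text \<open>The optimal cost is a Lyapunov function: the tail of an optimal sequence is a candidate
  at the next state for the shorter horizon, and lengthening the horizon again does not raise the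
  optimal cost.\<close>

lemma receding_horizon_stable:
  assumes N: "1 \<le> N" and fb: "\<And>x. \<exists>u. fb x = u 0 \<and> (\<forall>v. cost N x u \<le> cost N x v)"
  shows "asymptotically_stable_origin (\<lambda>x. A *v x + B *v fb x)"
proof -
  define f where "f x = A *v x + B *v fb x" for x
  define V where "V = opt_cost N"
  obtain M where M: "N = Suc M" using N by (cases N) auto
  have descent: "V (f x) + hx x + hu (fb x) \<le> V x" for x
  proof -
    obtain u where u: "fb x = u 0" "\<And>v. cost N x u \<le> cost N x v" using fb by blast
    have "V (f x) \<le> opt_cost M (f x)" using opt_cost_antimono by (simp add: V_def M)
    also have "\<dots> \<le> cost M (f x) (\<lambda>i. u (Suc i))" by (rule opt_cost_le)
    also have "\<dots> = cost N x u - hx x - hu (fb x)" by (simp add: M cost_Suc f_def u(1))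
    also have "cost N x u \<le> V x" using opt_cost_attained[of N x] u(2) unfolding V_def by metis
    finally show ?thesis by simp
  qed
  have V: "convex_on UNIV V" "V 0 = 0" "\<And>x. x \<noteq> 0 \<Longrightarrow> 0 < V x" "\<And>x. 0 \<le> V x"
    by (auto simp: V_def opt_cost_convex opt_cost_0 opt_cost_pos opt_cost_nonneg)
  have V_le: "V ((f ^^ k) x) \<le> V x" for k x
  proof (induction k)
    case (Suc k)
    then show ?case
      using descent[of "(f ^^ k) x"] hx_nonneg[of "(f ^^ k) x"] hu_nonneg[of "fb ((f ^^ k) x)"] by simp
  qed simp
  have "\<exists>d>0. \<forall>x. norm x < d \<longrightarrow> (\<forall>k. norm ((f ^^ k) x) < e)" if e: "0 < e" for e
  proof -
    obtain m where m: "0 < m" "\<And>x. e \<le> norm x \<Longrightarrow> m * norm x \<le> V x"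
      using convex_positive_definite_lower_bound[OF V(1-3) e] by blast
    have "continuous (at 0) V"
      using convex_on_continuous[OF open_UNIV V(1)] by (simp add: continuous_on_eq_continuous_at)
    \<comment> \<open>Outside the ball of radius \<open>e\<close> the value \<open>V\<close> is at
      least \<open>m * e\<close>. As \<open>V\<close> never rises along the closed loop, a start
      below this level prevents leaving the ball.\<close>
    then obtain d where d: "0 < d" "\<And>x. dist x 0 < d \<Longrightarrow> dist (V x) (V 0) < m * e"
      using m(1) e unfolding continuous_at_eps_delta by (metis mult_pos_pos)
    have "norm ((f ^^ k) x) < e" if x: "norm x < d" for k x
    proof (rule ccontr)
      assume *: "\<not> norm ((f ^^ k) x) < e"
      then have "m * e \<le> m * norm ((f ^^ k) x)" using m(1) by simp
      also have "\<dots> \<le> V ((f ^^ k) x)" using * by (intro m(2)) simp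
      also have "\<dots> \<le> V x" by (rule V_le)
      also have "\<dots> < m * e" using d(2)[of x] x by (simp add: V(2))
      finally show False by simp
    qed
    then show ?thesis using d(1) by blast
  qed
  moreover have "(\<lambda>k. (f ^^ k) x) \<longlonglongrightarrow> 0" for x
  proof -
    define xs where "xs k = (f ^^ k) x" for k
    define us where "us k = fb (xs k)" for k
    have rec: "xs (Suc k) = A *v xs k + B *v us k" for k by (simp add: xs_def us_def f_def)
    have step: "V (xs (Suc k)) + hx (xs k) + hu (us k) \<le> V (xs k)" for k
      using descent[of "xs k"] by (simp add: xs_def us_def)
    have "decseq (\<lambda>k. V (xs k))"
      by (rule decseq_SucI) (smt (verit) step hx_nonneg hu_nonneg)
    moreover have "\<And>k. 0 \<le> V (xs k)" using V(4) by simp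
    ultimately obtain l where l: "(\<lambda>k. V (xs k)) \<longlonglongrightarrow> l"
      using decseq_convergent by metis
    \<comment> \<open>Consecutive values share one limit, so their differences tend to 0; by
      \<open>step\<close> these dominate both parts of the stage cost.\<close>
    have "(\<lambda>k. V (xs k) - V (xs (Suc k))) \<longlonglongrightarrow> l - l"
      by (intro tendsto_diff l LIMSEQ_Suc)
    then have diff: "(\<lambda>k. V (xs k) - V (xs (Suc k))) \<longlonglongrightarrow> 0" by simp
    have out: "(\<lambda>k. hx (xs k)) \<longlonglongrightarrow> 0"
      by (rule tendsto_sandwich[OF _ _ tendsto_const diff])
        (auto intro!: always_eventually hx_nonneg, smt (verit) step hu_nonneg)
    have "(\<lambda>k. (V (xs k) - V (xs (Suc k))) / c) \<longlonglongrightarrow> 0 / c"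
      using c_pos by (intro tendsto_intros diff) auto
    then have diff': "(\<lambda>k. (V (xs k) - V (xs (Suc k))) / c) \<longlonglongrightarrow> 0" by simp
    have "(norm (us k))\<^sup>2 \<le> (V (xs k) - V (xs (Suc k))) / c" for k
      using step[of k] hu_ge[of "us k"] hx_nonneg[of "xs k"] c_pos by (simp add: field_simps)
    then have "(\<lambda>k. (norm (us k))\<^sup>2) \<longlonglongrightarrow> 0"
      by (intro tendsto_sandwich[OF _ _ tendsto_const diff']) auto
    then have "(\<lambda>k. sqrt ((norm (us k))\<^sup>2)) \<longlonglongrightarrow> sqrt 0" by (rule tendsto_real_sqrt)
    then have us: "us \<longlonglongrightarrow> 0" by (simp add: tendsto_norm_zero_iff)
    obtain m where m: "0 < m" "\<And>x. 1 \<le> norm x \<Longrightarrow> m * norm x \<le> V x"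
      using convex_positive_definite_lower_bound[OF V(1-3) zero_less_one] by blast
    have "norm (xs k) \<le> max 1 (V x / m)" for k
    proof (cases "1 \<le> norm (xs k)")
      case True
      then have "m * norm (xs k) \<le> V x" using m(2)[OF True] V_le[of k x] by (simp add: xs_def)
      then have "norm (xs k) \<le> V x / m" using m(1) by (simp add: field_simps)
      then show ?thesis by simp
    qed simp
    then have "bounded (range xs)" by (auto simp: bounded_iff intro!: exI[of _ "max 1 (V x / m)"])
    then have "xs \<longlonglongrightarrow> 0" by (rule vanishing_stage_cost_imp_tendsto_0[OF rec us out])
    then show ?thesis unfolding xs_def .
  qed
  ultimately have "asymptotically_stable_origin f" unfolding asymptotically_stable_origin_def by blast
  then show ?thesis unfolding f_def .
qed

end

section \<open>Recentered relaxed barriers\<close>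

definition Bhat_deriv :: "real \<Rightarrow> real \<Rightarrow> real" where
  "Bhat_deriv \<delta> z = (if z > \<delta> then - 1 / z else (z - 2 * \<delta>) / \<delta>\<^sup>2)"

text \<open>At \<open>z = \<delta>\<close> both branches have value \<open>- ln \<delta>\<close> and
  slope \<open>- 1 / \<delta>\<close>, so they glue to a differentiable function.\<close>

lemma Bhat_has_derivative:
  assumes "0 < \<delta>"
  shows "(Bhat \<delta> has_real_derivative Bhat_deriv \<delta> z) (at z)"
proof -
  have 1: "((\<lambda>z. - ln z) has_real_derivative - 1 / y) (at y within T)" if "0 < y" for y T
    using that by (auto intro!: derivative_eq_intros)
  have 2: "(beta2 \<delta> has_real_derivative (y - 2 * \<delta>) / \<delta>\<^sup>2) (at y within T)" for y T
    unfolding beta2_def using assms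
    by (auto intro!: derivative_eq_intros simp: power2_eq_square field_simps)
  have "((\<lambda>z. if z \<in> {\<delta><..} then - ln z else beta2 \<delta> z) has_vector_derivative
      (if z \<in> {\<delta><..} then - 1 / z else (z - 2 * \<delta>) / \<delta>\<^sup>2)) (at z within UNIV)"
  proof (rule has_vector_derivative_If_within_closures)
    show "((\<lambda>z. - ln z) has_vector_derivative - 1 / z) (at z within {\<delta><..} \<union> closure {\<delta><..} \<inter> closure {..\<delta>})"
      if "z \<in> {\<delta><..} \<union> closure {\<delta><..} \<inter> closure {..\<delta>}"
      using that assms by (intro has_real_derivative_iff_has_vector_derivative[THEN iffD1] 1) auto
    show "(beta2 \<delta> has_vector_derivative (z - 2 * \<delta>) / \<delta>\<^sup>2) (at z within {..\<delta>} \<union> closure {\<delta><..} \<inter> closure {..\<delta>})"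
      by (intro has_real_derivative_iff_has_vector_derivative[THEN iffD1] 2)
  qed (use assms in \<open>auto simp: beta2_def power2_eq_square field_simps\<close>)
  then show ?thesis
    by (simp add: Bhat_def[abs_def] Bhat_deriv_def has_real_derivative_iff_has_vector_derivative)
qed

lemma Bhat_deriv_strict_mono:
  assumes \<delta>: "0 < \<delta>" and "y < z"
  shows "Bhat_deriv \<delta> y < Bhat_deriv \<delta> z"
proof -
  consider "\<delta> < y" | "y \<le> \<delta>" "\<delta> < z" | "z \<le> \<delta>" using assms by linarith
  then show ?thesis
  proof cases
    case 2
    have "(y - 2 * \<delta>) / \<delta>\<^sup>2 \<le> (\<delta> - 2 * \<delta>) / \<delta>\<^sup>2" using 2 \<delta> by (intro divide_right_mono) auto
    also have "\<dots> = - 1 / \<delta>" using \<delta> by (simp add: power2_eq_square)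
    also have "\<dots> < - 1 / z" using 2 \<delta> by (simp add: field_simps)
    finally show ?thesis using 2 by (simp add: Bhat_deriv_def)
  qed (use assms in \<open>auto simp: Bhat_deriv_def field_simps\<close>)
qed

text \<open>This curvature bound is where the factor \<open>1 / (2 * \<delta>\<^sup>2)\<close> of \<open>Mmat\<close> comes from.\<close>
lemma Bhat_deriv_lipschitz:
  assumes \<delta>: "0 < \<delta>" and "y \<le> z"
  shows "Bhat_deriv \<delta> z - Bhat_deriv \<delta> y \<le> (z - y) / \<delta>\<^sup>2"
proof -
  \<comment> \<open>Here \<open>y' * z'\<close> is at least \<open>\<delta>\<^sup>2\<close>. The
    endpoint \<open>\<delta>\<close> is included so that the mixed case can be split there.\<close>
  have outer: "- 1 / z' - (- 1 / y') \<le> (z' - y') / \<delta>\<^sup>2" if "\<delta> \<le> y'" "y' \<le> z'" for y' z'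
  proof -
    have "- 1 / z' - (- 1 / y') = (z' - y') / (y' * z')" using that \<delta> by (simp add: field_simps)
    also have "\<dots> \<le> (z' - y') / \<delta>\<^sup>2"
      using that \<delta> by (intro divide_left_mono) (auto simp: power2_eq_square intro!: mult_mono)
    finally show ?thesis .
  qed
  consider "\<delta> < y" | "y \<le> \<delta>" "\<delta> < z" | "z \<le> \<delta>" using assms by linarith
  then show ?thesis
  proof cases
    case 1 then show ?thesis using outer[of y z] assms by (simp add: Bhat_deriv_def)
  next
    case 2
    have "- 1 / \<delta> - (y - 2 * \<delta>) / \<delta>\<^sup>2 = (\<delta> - y) / \<delta>\<^sup>2"
      using \<delta> by (simp add: power2_eq_square field_simps)
    moreover have "(\<delta> - y) / \<delta>\<^sup>2 + (z - \<delta>) / \<delta>\<^sup>2 = (z - y) / \<delta>\<^sup>2" by (simp flip: add_divide_distrib)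
    ultimately show ?thesis using outer[of \<delta> z] 2 by (simp add: Bhat_deriv_def)
  next
    case 3 then show ?thesis using assms by (simp add: Bhat_deriv_def flip: diff_divide_distrib)
  qed
qed

lemma strict_mono_deriv_above_tangent:
  fixes f :: "real \<Rightarrow> real"
  assumes der: "\<And>x. (f has_real_derivative f' x) (at x)" and mono: "\<And>x y. x < y \<Longrightarrow> f' x < f' y"
    and "x \<noteq> y"
  shows "f x + f' x * (y - x) < f y"
proof (cases "x < y")
  case True
  then obtain z where z: "x < z" "z < y" "f y - f x = (y - x) * f' z"
    using MVT2[of x y f f'] der by blast
  then show ?thesis using mono[of x z] by (smt (verit) mult.commute mult_strict_right_mono)
next
  case False
  then have "y < x" using \<open>x \<noteq> y\<close> by simp
  then obtain z where z: "y < z" "z < x" "f x - f y = (x - y) * f' z"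
    using MVT2[of y x f f'] der by blast
  have "(x - y) * f' z < (x - y) * f' x" using mono[of z x] z by (intro mult_strict_left_mono) auto
  then show ?thesis using z(3) by (simp add: algebra_simps)
qed

text \<open>The Bregman divergence of the barrier with base point \<open>a\<close>. Adding an affine
  function to the barrier, as recentering does, leaves it unchanged.\<close>

definition Bhat_gap :: "real \<Rightarrow> real \<Rightarrow> real \<Rightarrow> real" where
  "Bhat_gap \<delta> a z = Bhat \<delta> z - Bhat \<delta> a - Bhat_deriv \<delta> a * (z - a)"

context
  fixes \<delta> :: real assumes \<delta>: "0 < \<delta>"
begin

lemma Bhat_gap_pos: "z \<noteq> a \<Longrightarrow> 0 < Bhat_gap \<delta> a z"
  using strict_mono_deriv_above_tangent[of "Bhat \<delta>" "Bhat_deriv \<delta>" a z]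
    Bhat_has_derivative[OF \<delta>] Bhat_deriv_strict_mono[OF \<delta>] by (simp add: Bhat_gap_def)

lemma Bhat_gap_nonneg: "0 \<le> Bhat_gap \<delta> a z"
  using Bhat_gap_pos[of z a] by (cases "z = a") (auto simp: Bhat_gap_def)

text \<open>By the curvature bound, \<open>z\<^sup>2 / (2 * \<delta>\<^sup>2)\<close> minus the
  barrier is convex; that it lies above its tangent at \<open>a\<close> is the claim
  rearranged.\<close>

lemma Bhat_gap_le: "Bhat_gap \<delta> a z \<le> (z - a)\<^sup>2 / (2 * \<delta>\<^sup>2)"
proof -
  let ?f = "\<lambda>z. z\<^sup>2 / (2 * \<delta>\<^sup>2) - Bhat \<delta> z" and ?f' = "\<lambda>z. z / \<delta>\<^sup>2 - Bhat_deriv \<delta> z"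
  have der: "(?f has_real_derivative ?f' x) (at x)" for x
    using \<delta> by (auto intro!: derivative_eq_intros Bhat_has_derivative simp: field_simps)
  have conv: "convex_on UNIV ?f"
    by (rule convex_on_realI[OF _ der])
      (use Bhat_deriv_lipschitz[OF \<delta>] in \<open>auto simp: diff_divide_distrib algebra_simps\<close>)
  have "?f' a * (z - a) \<le> ?f z - ?f a"
    by (rule convex_on_imp_above_tangent[OF conv]) (use der[of a] in auto)
  moreover have "z\<^sup>2 / (2 * \<delta>\<^sup>2) - a\<^sup>2 / (2 * \<delta>\<^sup>2) - a / \<delta>\<^sup>2 * (z - a) = (z - a)\<^sup>2 / (2 * \<delta>\<^sup>2)"
    using \<delta> by (simp add: field_simps power2_eq_square)
  ultimately show ?thesis by (simp add: Bhat_gap_def algebra_simps)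
qed

lemma Bhat_gap_convex: "convex_on UNIV (Bhat_gap \<delta> a)"
proof (rule convex_on_realI)
  show "(Bhat_gap \<delta> a has_real_derivative Bhat_deriv \<delta> z - Bhat_deriv \<delta> a) (at z)" for z
    unfolding Bhat_gap_def[abs_def]
    by (auto intro!: derivative_eq_intros Bhat_has_derivative \<delta>)
  show "Bhat_deriv \<delta> y - Bhat_deriv \<delta> a \<le> Bhat_deriv \<delta> z - Bhat_deriv \<delta> a" if "y \<le> z" for y z
    using Bhat_deriv_strict_mono[OF \<delta>, of y z] that by (cases "y = z") auto
qed auto

text \<open>Vanishing value and gradient at the origin remove the affine part of the recentered barrier,
  whichever recentering is used.\<close>
lemma rbar_eq_sum_gap:
  fixes C :: "real^'a^'p"
  assumes g: "g \<Longrightarrow> w = 0"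
    and val: "rbar g \<delta> C d w 0 = 0" and der: "(rbar g \<delta> C d w has_derivative (\<lambda>h. 0)) (at 0)"
  shows "rbar g \<delta> C d w x = (\<Sum>i\<in>UNIV. (1 + w $ i) * Bhat_gap \<delta> (d $ i) (d $ i - C $ i \<bullet> x))"
proof -
  \<comment> \<open>The linear correction of gradient recentering; as \<open>w = 0\<close> in that
    case, one formula covers both kinds.\<close>
  define b where "b i = (if g then 1 / d $ i else 0)" for i
  define lin where "lin h = (\<Sum>i\<in>UNIV. (1 + w $ i) * (Bhat_deriv \<delta> (d $ i) * (- (C $ i \<bullet> h))) - b i * (C $ i \<bullet> h))"
    for h
  have rb: "rbar g \<delta> C d w =
      (\<lambda>x. \<Sum>i\<in>UNIV. (1 + w $ i) * (Bhat \<delta> (d $ i - C $ i \<bullet> x) + ln (d $ i)) - b i * (C $ i \<bullet> x))"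
    using g by (auto simp: rbar_def b_def fun_eq_iff)
  have summand: "((\<lambda>x. Bhat \<delta> (d $ i - C $ i \<bullet> x)) has_derivative
      (\<lambda>h. Bhat_deriv \<delta> (d $ i) * (- (C $ i \<bullet> h)))) (at 0)" for i
  proof -
    have 1: "((\<lambda>x. d $ i - C $ i \<bullet> x) has_derivative (\<lambda>h. - (C $ i \<bullet> h))) (at 0)"
      by (auto intro!: derivative_eq_intros)
    have 2: "(Bhat \<delta> has_derivative (*) (Bhat_deriv \<delta> (d $ i))) (at (d $ i - C $ i \<bullet> 0))"
      using Bhat_has_derivative[OF \<delta>, of "d $ i"] by (simp add: has_field_derivative_def)
    show ?thesis using has_derivative_compose[OF 1 2] .
  qed
  have "(rbar g \<delta> C d w has_derivative lin) (at 0)"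
    unfolding rb lin_def
    by (intro has_derivative_sum has_derivative_diff has_derivative_mult_right)
      (auto intro!: derivative_eq_intros summand)
  then have "lin = (\<lambda>h. 0)" using der has_derivative_unique by blast
  then have "lin x = 0" by simp
  moreover have "rbar g \<delta> C d w x - rbar g \<delta> C d w 0 - lin x
      = (\<Sum>i\<in>UNIV. (1 + w $ i) * Bhat_gap \<delta> (d $ i) (d $ i - C $ i \<bullet> x))"
    unfolding rb lin_def sum_subtractf[symmetric]
    by (intro sum.cong) (auto simp: Bhat_gap_def algebra_simps)
  ultimately show ?thesis using val by simp
qed

end

section \<open>Comparison of the barrier with the quadratic form of \<open>Mmat\<close>\<close>

lemma Mmat_form:
  "x \<bullet> (Mmat \<delta> C w *v y) = (\<Sum>i\<in>UNIV. (1 + w $ i) * ((C $ i \<bullet> x) * (C $ i \<bullet> y)) / (2 * \<delta>\<^sup>2))"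
proof -
  have comp: "(C *v y) $ i = C $ i \<bullet> y" for i y
    by (simp add: matrix_vector_mult_def inner_vec_def)
  have diag: "(diag_mat v *v z) $ i = v $ i * z $ i" for v z and i
    by (simp add: diag_mat_def matrix_vector_mult_def if_distrib[of "\<lambda>a. a * _"] cong: if_cong)
  have "x \<bullet> (Mmat \<delta> C w *v y) = (1 / (2 * \<delta>\<^sup>2)) * ((C *v x) \<bullet> (diag_mat (1 + w) *v (C *v y)))"
    by (simp add: Mmat_def scaleR_matrix_vector_assoc[symmetric] inner_matrix_vector_transpose[of x "transpose C"]
        flip: matrix_vector_mul_assoc)
  also have "\<dots> = (\<Sum>i\<in>UNIV. (1 + w $ i) * ((C $ i \<bullet> x) * (C $ i \<bullet> y)) / (2 * \<delta>\<^sup>2))"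
    unfolding inner_vec_def[of "C *v x"] sum_distrib_left
    by (intro sum.cong) (auto simp: comp diag mult.commute mult.left_commute)
  finally show ?thesis .
qed

lemma Mmat_psd:
  assumes "\<And>i. 0 \<le> w $ i"
  shows "psd_mat (Mmat \<delta> C w)"
  unfolding psd_mat_def
proof
  \<comment> \<open>Symmetry is read off the bilinear form, which \<open>Mmat_form\<close> shows to
    be symmetric in its two vectors.\<close>
  have "x \<bullet> (transpose (Mmat \<delta> C w) *v y) = x \<bullet> (Mmat \<delta> C w *v y)" for x y
  proof -
    have "x \<bullet> (transpose (Mmat \<delta> C w) *v y) = y \<bullet> (Mmat \<delta> C w *v x)"
      by (simp add: inner_matrix_vector_transpose[of x "transpose _"] inner_commute)
    then show ?thesis by (simp add: Mmat_form mult.commute mult.left_commute)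
  qed
  then show "transpose (Mmat \<delta> C w) = Mmat \<delta> C w"
    by (metis matrix_eq vector_eq_ldot)
  have "0 \<le> 1 + w $ i" for i using assms[of i] by simp
  then show "\<forall>x. 0 \<le> x \<bullet> (Mmat \<delta> C w *v x)" by (auto simp: Mmat_form intro!: sum_nonneg)
qed

context
  fixes g :: bool and \<delta> :: real and C :: "real^'a^'p" and d w :: "real^'p"
  assumes \<delta>: "0 < \<delta>" and rec: "if g then w = 0 else weight_recentered C d w"
    and val: "rbar g \<delta> C d w 0 = 0" and der: "(rbar g \<delta> C d w has_derivative (\<lambda>h. 0)) (at 0)"
begin

lemma recentering_weight_nonneg: "0 \<le> w $ i"
  using rec by (auto simp: weight_recentered_def split: if_splits)

lemma recentering_factor_pos: "0 < 1 + w $ i"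
  using recentering_weight_nonneg[of i] by simp

lemma rbar_gap:
  "rbar g \<delta> C d w x = (\<Sum>i\<in>UNIV. (1 + w $ i) * Bhat_gap \<delta> (d $ i) (d $ i - C $ i \<bullet> x))"
  by (rule rbar_eq_sum_gap[OF \<delta> _ val der]) (use rec in simp)

lemma rbar_nonneg: "0 \<le> rbar g \<delta> C d w x"
  unfolding rbar_gap using recentering_factor_pos Bhat_gap_nonneg[OF \<delta>]
  by (intro sum_nonneg mult_nonneg_nonneg) (auto intro: less_imp_le)

text \<open>Summand by summand, this is \<open>Bhat_gap_le\<close> with displacement
  \<open>C $ i \<bullet> x\<close>.\<close>

lemma rbar_le_Mmat: "rbar g \<delta> C d w x \<le> x \<bullet> (Mmat \<delta> C w *v x)"
  unfolding rbar_gap Mmat_form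
proof (rule sum_mono)
  fix i
  have "(1 + w $ i) * Bhat_gap \<delta> (d $ i) (d $ i - C $ i \<bullet> x) \<le> (1 + w $ i) * ((C $ i \<bullet> x)\<^sup>2 / (2 * \<delta>\<^sup>2))"
    using Bhat_gap_le[OF \<delta>, of "d $ i" "d $ i - C $ i \<bullet> x"] recentering_factor_pos[of i]
    by (intro mult_left_mono) auto
  then show "(1 + w $ i) * Bhat_gap \<delta> (d $ i) (d $ i - C $ i \<bullet> x)
      \<le> (1 + w $ i) * ((C $ i \<bullet> x) * (C $ i \<bullet> x)) / (2 * \<delta>\<^sup>2)"
    by (simp add: power2_eq_square)
qed

text \<open>A gap vanishes only at its base point, so a zero sum makes every
  \<open>C $ i \<bullet> x\<close> zero, and \<open>Mmat\<close> depends on \<open>x\<close> only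
  through these numbers.\<close>

lemma rbar_zero_imp_kernel:
  assumes "rbar g \<delta> C d w x = 0"
  shows "Mmat \<delta> C w *v x = 0"
proof -
  have "C $ i \<bullet> x = 0" for i
  proof (rule ccontr)
    assume "C $ i \<bullet> x \<noteq> 0"
    then have "0 < (1 + w $ i) * Bhat_gap \<delta> (d $ i) (d $ i - C $ i \<bullet> x)"
      using recentering_factor_pos[of i] Bhat_gap_pos[OF \<delta>] by simp
    then have "0 < rbar g \<delta> C d w x"
      unfolding rbar_gap using recentering_factor_pos Bhat_gap_nonneg[OF \<delta>]
      by (intro sum_pos2[where i = i] mult_nonneg_nonneg) (auto intro: less_imp_le)
    then show False using assms by simp
  qed
  then have "y \<bullet> (Mmat \<delta> C w *v x) = 0" for y by (simp add: Mmat_form)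
  then show ?thesis by (metis inner_eq_zero_iff)
qed

text \<open>Each summand is a convex gap composed with an affine map, with positive weight.\<close>

lemma rbar_convex: "convex_on UNIV (rbar g \<delta> C d w)"
proof (rule convex_onI)
  fix t :: real and x y assume t: "0 < t" "t < 1"
  let ?G = "\<lambda>i x. (1 + w $ i) * Bhat_gap \<delta> (d $ i) (d $ i - C $ i \<bullet> x)"
  have "?G i ((1 - t) *\<^sub>R x + t *\<^sub>R y) \<le> (1 - t) * ?G i x + t * ?G i y" for i
  proof -
    have "Bhat_gap \<delta> (d $ i) ((1 - t) *\<^sub>R (d $ i - C $ i \<bullet> x) + t *\<^sub>R (d $ i - C $ i \<bullet> y))
        \<le> (1 - t) * Bhat_gap \<delta> (d $ i) (d $ i - C $ i \<bullet> x) + t * Bhat_gap \<delta> (d $ i) (d $ i - C $ i \<bullet> y)"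
      using t by (intro convex_onD[OF Bhat_gap_convex[OF \<delta>]]) auto
    moreover have "(1 - t) *\<^sub>R (d $ i - C $ i \<bullet> x) + t *\<^sub>R (d $ i - C $ i \<bullet> y)
        = d $ i - C $ i \<bullet> ((1 - t) *\<^sub>R x + t *\<^sub>R y)"
      by (simp add: inner_add_right algebra_simps)
    ultimately have "?G i ((1 - t) *\<^sub>R x + t *\<^sub>R y) \<le> (1 + w $ i) * ((1 - t) * Bhat_gap \<delta> (d $ i) (d $ i - C $ i \<bullet> x)
        + t * Bhat_gap \<delta> (d $ i) (d $ i - C $ i \<bullet> y))"
      using recentering_factor_pos[of i] by (intro mult_left_mono) auto
    then show ?thesis by (simp add: algebra_simps)
  qed
  then have "(\<Sum>i\<in>UNIV. ?G i ((1 - t) *\<^sub>R x + t *\<^sub>R y)) \<le> (\<Sum>i\<in>UNIV. (1 - t) * ?G i x + t * ?G i y)"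
    by (rule sum_mono)
  then show "rbar g \<delta> C d w ((1 - t) *\<^sub>R x + t *\<^sub>R y) \<le> (1 - t) * rbar g \<delta> C d w x + t * rbar g \<delta> C d w y"
    unfolding rbar_gap by (simp add: sum.distrib sum_distrib_left)
qed simp

end

section \<open>Stability of the relaxed MPC feedback\<close>

theorem theorem5:
  fixes A :: "real^'n^'n" and B :: "real^'m^'n"
    and Cx :: "real^'n^'p" and dx :: "real^'p" and wx :: "real^'p"
    and Cu :: "real^'m^'q" and du :: "real^'q" and wu :: "real^'q"
    and Q :: "real^'n^'n" and R :: "real^'m^'m"
    and P :: "real^'n^'n" and K :: "real^'n^'m"
    and N :: nat and \<epsilon> \<delta> :: real and gx gu :: bool
  assumes stab: "stabilizable A B"
    and U_compact: "compact {u. \<forall>i. (Cu $ i) \<bullet> u \<le> du $ i}"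
    and dx_pos: "\<forall>i. 0 < dx $ i" and du_pos: "\<forall>i. 0 < du $ i"
    and Q_psd: "psd_mat Q" and R_pd: "pd_mat R"
    and N_pos: "1 \<le> N" and eps_pos: "0 < \<epsilon>" and delta_pos: "0 < \<delta>"
    and wx_rec: "if gx then wx = 0 else weight_recentered Cx dx wx"
    and wu_rec: "if gu then wu = 0 else weight_recentered Cu du wu"
    and adm_x: "rbar gx \<delta> Cx dx wx 0 = 0" "(rbar gx \<delta> Cx dx wx has_derivative (\<lambda>h. 0)) (at 0)"
    and adm_u: "rbar gu \<delta> Cu du wu 0 = 0" "(rbar gu \<delta> Cu du wu has_derivative (\<lambda>h. 0)) (at 0)"
    and K_eq: "K = - (matrix_inv (R + transpose B ** P ** B + \<epsilon> *\<^sub>R Mmat \<delta> Cu wu) ** transpose B ** P ** A)"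
    and P_eq: "P = transpose (A + B ** K) ** P ** (A + B ** K)
                   + transpose K ** (R + \<epsilon> *\<^sub>R Mmat \<delta> Cu wu) ** K + Q + \<epsilon> *\<^sub>R Mmat \<delta> Cx wx"
    and P_pd: "pd_mat P"
  shows "asymptotically_stable_origin
           (\<lambda>x. A *v x + B *v mpc_feedback A B Q R P N \<epsilon> \<delta> gx Cx dx wx gu Cu du wu x)"
proof -
  let ?Mx = "Mmat \<delta> Cx wx" and ?Mu = "Mmat \<delta> Cu wu"
  let ?bx = "rbar gx \<delta> Cx dx wx" and ?bu = "rbar gu \<delta> Cu du wu"
  note bx = delta_pos wx_rec adm_x and bu = delta_pos wu_rec adm_u
  define hx where "hx x = x \<bullet> (Q *v x) + \<epsilon> * ?bx x" for x
  define hu where "hu u = u \<bullet> (R *v u) + \<epsilon> * ?bu u" for u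
  \<comment> \<open>Coercivity of the input cost comes from \<open>R\<close>; the nonnegative
    barrier only adds to it.\<close>
  obtain c where c: "0 < c" "\<And>u. c * (norm u)\<^sup>2 \<le> u \<bullet> (R *v u)"
    using pd_mat_lower_bound[OF R_pd] by blast
  have Q_nonneg: "0 \<le> x \<bullet> (Q *v x)" for x using Q_psd by (simp add: psd_mat_def)
  have ebx: "0 \<le> \<epsilon> * ?bx x" and ebu: "0 \<le> \<epsilon> * ?bu u" for x u
    using rbar_nonneg[OF bx] rbar_nonneg[OF bu] eps_pos by simp_all
  have apply_sum: "(M + \<epsilon> *\<^sub>R M') *v x = M *v x + \<epsilon> *\<^sub>R (M' *v x)" for M M' :: "real^'z^'z" and x
    by (simp add: matrix_vector_mult_add_rdistrib scaleR_matrix_vector_assoc)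
  \<comment> \<open>Absorbing the barrier matrices into \<open>Q\<close> and \<open>R\<close> turns
    the modified Riccati equation into an ordinary one.\<close>
  interpret riccati_mpc A B P "Q + \<epsilon> *\<^sub>R ?Mx" "R + \<epsilon> *\<^sub>R ?Mu" K hx hu c
  proof
    have "psd_mat ?Mu" using recentering_weight_nonneg[OF bu] by (rule Mmat_psd)
    then show "pd_mat (R + \<epsilon> *\<^sub>R ?Mu)"
      using R_pd eps_pos
      by (auto simp: pd_mat_def psd_mat_def apply_sum inner_add_right add_pos_nonneg)
        (simp add: transpose_def vec_eq_iff)
    show "K = - (matrix_inv (R + \<epsilon> *\<^sub>R ?Mu + transpose B ** P ** B) ** transpose B ** P ** A)"
      by (subst K_eq) (simp add: add_ac)
    show "P = transpose (A + B ** K) ** P ** (A + B ** K) + transpose K ** (R + \<epsilon> *\<^sub>R ?Mu) ** K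
        + (Q + \<epsilon> *\<^sub>R ?Mx)"
      using P_eq by (simp only: add.assoc)
    show "convex_on UNIV hx" "convex_on UNIV hu"
      unfolding hx_def[abs_def] hu_def[abs_def] using eps_pos
      by (intro convex_on_add convex_on_cmul psd_mat_convex Q_psd pd_imp_psd R_pd
          rbar_convex[OF bx] rbar_convex[OF bu]; simp)+
    show "hx 0 = 0" "hu 0 = 0" by (simp_all add: hx_def hu_def adm_x adm_u)
    show "0 \<le> hx x" for x using Q_nonneg[of x] ebx[of x] by (simp add: hx_def)
    show "hx x \<le> x \<bullet> ((Q + \<epsilon> *\<^sub>R ?Mx) *v x)" for x
      using rbar_le_Mmat[OF bx, of x] eps_pos by (simp add: hx_def apply_sum inner_add_right)
    show "hu u \<le> u \<bullet> ((R + \<epsilon> *\<^sub>R ?Mu) *v u)" for u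
      using rbar_le_Mmat[OF bu, of u] eps_pos by (simp add: hu_def apply_sum inner_add_right)
    show "c * (norm u)\<^sup>2 \<le> hu u" for u using c(2)[of u] ebu[of u] by (simp add: hu_def)
    show "(Q + \<epsilon> *\<^sub>R ?Mx) *v x = 0" if "hx x = 0" for x
    proof -
      have "x \<bullet> (Q *v x) = 0" "\<epsilon> * ?bx x = 0"
        using that Q_nonneg[of x] ebx[of x] unfolding hx_def by linarith+
      then show ?thesis
        using psd_mat_zero_imp_kernel[OF Q_psd] rbar_zero_imp_kernel[OF bx] eps_pos by (simp add: apply_sum)
    qed
  qed (use stab P_pd c in auto)
  have cost: "relaxed_cost A B Q R P N \<epsilon> \<delta> gx Cx dx wx gu Cu du wu x u = cost N x u" for x u
    by (simp add: relaxed_cost_def cost_def lhat_def hx_def hu_def algebra_simps)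
  show ?thesis
  proof (rule receding_horizon_stable[OF N_pos])
    fix x
    \<comment> \<open>An attained minimum ensures that the choice in \<open>mpc_feedback\<close>
      picks a minimiser.\<close>
    have "\<exists>u. \<forall>v. cost N x u \<le> cost N x v" by (metis opt_cost_attained opt_cost_le)
    from someI_ex[OF this]
    show "\<exists>u. mpc_feedback A B Q R P N \<epsilon> \<delta> gx Cx dx wx gu Cu du wu x = u 0
        \<and> (\<forall>v. cost N x u \<le> cost N x v)"
      unfolding mpc_feedback_def cost by blast
  qed
qed

end
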